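(* Let $0<\alpha\le1$ and let $\mu_\alpha$ be the (weakly stable) probability measure on $\mathbb{R}$ with characteristic function $\widehat\mu_\alpha(t)=(1-|t|^\alpha)_+$. Then $$\mu_\alpha=\mu_1\circ\bigl(\alpha\,\widetilde\delta_1+(1-\alpha)\,\widetilde\pi_\alpha\bigr).$$
   Context: For Borel probability measures $\mu,\lambda$ on $\mathbb{R}$, $\mu\circ\lambda$ is the law of the product $Y\theta$ of independent $Y\sim\mu$ and $\theta\sim\lambda$. $\mu_1$ is the measure with characteristic function $(1-|t|)_+$. $\widetilde\delta_1=\frac12\delta_1+\frac12\delta_{-1}$, and $\widetilde\pi_\alpha$ is the symmetrized Pareto distribution with density $\frac{\alpha}{2|x|^{\alpha+1}}\mathbf{1}_{(1,\infty)}(|x|)$. $(y)_+=\max(y,0)$. *)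

theory Defs
  imports "HOL-Probability.Probability"
begin

definition mult_conv :: "real measure \<Rightarrow> real measure \<Rightarrow> real measure"  (infixl \<open>\<circ>\<^sub>m\<close> 70)
  where "M \<circ>\<^sub>m N = distr (M \<Otimes>\<^sub>M N) borel (\<lambda>(y, \<theta>). y * \<theta>)"

text \<open>The linear combination \<open>a M + b N\<close> of Borel measures on the line. The weights are meant to be
  nonnegative: \<^const>\<open>ennreal\<close> truncates negative weights to \<open>0\<close>.\<close>

definition mix :: "real \<Rightarrow> real measure \<Rightarrow> real \<Rightarrow> real measure \<Rightarrow> real measure"
  where "mix a M b N =
    measure_of UNIV (sets borel) (\<lambda>A. ennreal a * emeasure M A + ennreal b * emeasure N A)"

definition sym_dirac_one :: "real measure"
  where "sym_dirac_one = mix (1/2) (return borel 1) (1/2) (return borel (- 1))"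

definition sym_pareto :: "real \<Rightarrow> real measure"
  where "sym_pareto \<alpha> =
    density lborel (\<lambda>x. ennreal (\<alpha> / (2 * \<bar>x\<bar> powr (\<alpha> + 1)) * indicator {1<..} \<bar>x\<bar>))"

lemma space_mix [simp]: "space (mix a M b N) = UNIV"
  by (simp add: mix_def space_measure_of_conv)

lemma sets_mix [simp, measurable_cong]: "sets (mix a M b N) = sets borel"
  unfolding mix_def
  by (metis sets.sets_measure_of_eq sets_measure_of_conv space_borel subset_UNIV Pow_UNIV)

lemma emeasure_mix:
  assumes [simp]: "sets M = sets borel" "sets N = sets borel" and A: "A \<in> sets borel"
  shows "emeasure (mix a M b N) A = ennreal a * emeasure M A + ennreal b * emeasure N A"
  unfolding mix_def
proof (rule emeasure_measure_of_sigma)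
  show "sigma_algebra UNIV (sets (borel :: real measure))"
    using sets.sigma_algebra_axioms[of "borel :: real measure"] by simp
  show "positive (sets borel) (\<lambda>A. ennreal a * emeasure M A + ennreal b * emeasure N A)"
    by (simp add: positive_def)
  show "countably_additive (sets borel) (\<lambda>A. ennreal a * emeasure M A + ennreal b * emeasure N A)"
  proof (rule countably_additiveI)
    fix A :: "nat \<Rightarrow> real set"
    assume "range A \<subseteq> sets borel" "disjoint_family A"
    then have "(\<Sum>i. emeasure M (A i)) = emeasure M (\<Union>i. A i)"
      "(\<Sum>i. emeasure N (A i)) = emeasure N (\<Union>i. A i)"
      by (auto intro!: suminf_emeasure)
    then show "(\<Sum>i. ennreal a * emeasure M (A i) + ennreal b * emeasure N (A i))
        = ennreal a * emeasure M (\<Union>i. A i) + ennreal b * emeasure N (\<Union>i. A i)"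
      by (simp add: suminf_add[symmetric])
  qed
qed (fact A)

lemma real_distribution_mix:
  assumes "real_distribution M" "real_distribution N" "0 \<le> a" "0 \<le> b" "a + b = 1"
  shows "real_distribution (mix a M b N)"
proof -
  interpret M: real_distribution M by fact
  interpret N: real_distribution N by fact
  have "emeasure M UNIV = 1" "emeasure N UNIV = 1"
    using M.emeasure_space_1 N.emeasure_space_1 by simp_all
  then have "emeasure (mix a M b N) UNIV = 1"
    using assms(3-) by (simp add: emeasure_mix ennreal_plus[symmetric] del: ennreal_plus)
  then show ?thesis
    by (auto simp: real_distribution_def real_distribution_axioms_def intro: prob_spaceI)
qed

end

theory Submission
  imports Defs
begin

text \<open>
  Conditioning on the second factor, the characteristic function of \<open>M \<circ>\<^sub>m N\<close> at \<open>t\<close> is the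
  \<open>N\<close>-average of \<open>\<theta> \<mapsto> char M (t * \<theta>)\<close> (\<open>char_mult_conv\<close>).  When \<open>char M\<close> is the tent
  \<open>s \<mapsto> (1 - \<bar>s\<bar>)\<^sub>+\<close>, this average is a mixture of tents of varying width.  By Levy's
  uniqueness theorem it therefore suffices to write \<open>f s = (1 - s powr \<alpha>)\<^sub>+\<close>, for \<open>s > 0\<close>, as
  the mixture of the tents \<open>(1 - s * \<bar>\<theta>\<bar>)\<^sub>+\<close> under the given law of \<open>\<theta>\<close>
  (\<open>nn_integral_tent_mix\<close>).

  Such a representation exists because \<open>f\<close> is convex and decreasing on the half-line, with support
  in \<open>[0, 1]\<close>.  Taylor's formula with integral remainder at the end point \<open>1\<close> expresses \<open>f s\<close> as
  \<open>- f'(1-) * (1 - s)\<^sub>+\<close> plus the integral of \<open>(1 - s/r)\<^sub>+ * r * f''(r)\<close> over \<open>0 < r < 1\<close>.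
  Here \<open>- f'(1-) = \<alpha>\<close>, which is the weight of the atoms at \<open>1\<close> and \<open>-1\<close>, while
  \<open>r * f''(r) = \<alpha> * (1 - \<alpha>) * r powr (\<alpha> - 1)\<close>.  In terms of the reciprocal width \<open>x = 1/r\<close> the
  remainder carries the density \<open>(1 - \<alpha>) * \<alpha> / x powr (\<alpha> + 1)\<close> on \<open>x > 1\<close>: the Pareto density
  with weight \<open>1 - \<alpha>\<close>.  Once the mixing law is known, an explicit antiderivative confirms the
  identity (\<open>nn_integral_tent_pareto\<close>).
\<close>

section \<open>Characteristic functions of multiplicative convolutions\<close>

lemma real_distribution_mult_conv:
  assumes "real_distribution M" "real_distribution N"
  shows "real_distribution (M \<circ>\<^sub>m N)"
proof -
  interpret M: real_distribution M by fact
  interpret N: real_distribution N by fact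
  interpret P: pair_prob_space M N ..
  show ?thesis
    unfolding mult_conv_def by (rule P.real_distribution_distr) simp
qed

lemma char_mult_conv:
  assumes "real_distribution M" "real_distribution N"
  shows "char (M \<circ>\<^sub>m N) t = (\<integral>\<theta>. char M (t * \<theta>) \<partial>N)"
proof -
  interpret M: real_distribution M by fact
  interpret N: real_distribution N by fact
  interpret P: pair_prob_space M N ..
  have int: "integrable (M \<Otimes>\<^sub>M N) (\<lambda>(y, \<theta>). iexp (t * (y * \<theta>)))"
    by (rule P.integrable_const_bound[where B = 1]) (auto simp del: of_real_mult)
  have "char (M \<circ>\<^sub>m N) t = (\<integral>p. (case p of (y, \<theta>) \<Rightarrow> iexp (t * (y * \<theta>))) \<partial>(M \<Otimes>\<^sub>M N))"
    unfolding char_def mult_conv_def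
    by (subst integral_distr) (simp_all add: case_prod_unfold)
  also have "\<dots> = (\<integral>\<theta>. (\<integral>y. iexp (t * (y * \<theta>)) \<partial>M) \<partial>N)"
    by (rule P.integral_snd[symmetric, OF int])
  also have "\<dots> = (\<integral>\<theta>. char M (t * \<theta>) \<partial>N)"
    by (simp add: char_def ac_simps)
  finally show ?thesis .
qed

section \<open>Integration against the mixing measures\<close>

lemma nn_integral_mix:
  assumes sets: "sets M = sets borel" "sets N = sets borel"
    and f: "f \<in> borel_measurable borel"
  shows "(\<integral>\<^sup>+x. f x \<partial>mix a M b N) =
    ennreal a * (\<integral>\<^sup>+x. f x \<partial>M) + ennreal b * (\<integral>\<^sup>+x. f x \<partial>N)"
  using f
proof (induction rule: borel_measurable_induct)
  case (cong f g)
  then have "f = g" by auto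
  with cong show ?case by simp
next
  case (set A)
  then show ?case using sets by (simp add: emeasure_mix)
next
  case (mult u c)
  note [measurable_cong] = sets
  note [measurable] = mult(2)
  show ?case using mult by (simp add: nn_integral_cmult distrib_left ac_simps)
next
  case (add u v)
  note [measurable_cong] = sets
  note [measurable] = add(1,4)
  show ?case using add by (simp add: nn_integral_add distrib_left ac_simps)
next
  case (seq U)
  note [measurable_cong] = sets
  note [measurable] = seq(1)
  have incM: "incseq (\<lambda>i. ennreal a * (\<integral>\<^sup>+x. U i x \<partial>M))"
    and incN: "incseq (\<lambda>i. ennreal b * (\<integral>\<^sup>+x. U i x \<partial>N))"
    using \<open>incseq U\<close> by (auto simp: incseq_def le_fun_def intro!: mult_left_mono nn_integral_mono)
  have mono: "(\<integral>\<^sup>+x. (SUP i. U i x) \<partial>K) = (SUP i. \<integral>\<^sup>+x. U i x \<partial>K)"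
    if [measurable_cong]: "sets K = sets borel" for K
    by (rule nn_integral_monotone_convergence_SUP) (use \<open>incseq U\<close> in auto)
  show ?case
    using seq by (simp add: image_comp mono sets SUP_mult_left_ennreal ennreal_SUP_add[OF incM incN])
qed

lemma real_distribution_return: "real_distribution (return borel (x :: real))"
  by (simp add: real_distribution_def real_distribution_axioms_def prob_space_return)

lemma real_distribution_sym_dirac_one: "real_distribution sym_dirac_one"
  unfolding sym_dirac_one_def
  by (intro real_distribution_mix real_distribution_return) simp_all

lemma nn_integral_sym_dirac_one_even:
  fixes g :: "real \<Rightarrow> ennreal"
  assumes [measurable]: "g \<in> borel_measurable borel"
  shows "(\<integral>\<^sup>+x. g \<bar>x\<bar> \<partial>sym_dirac_one) = g 1"
proof -
  have "(\<integral>\<^sup>+x. g \<bar>x\<bar> \<partial>sym_dirac_one) = ennreal (1/2) * g 1 + ennreal (1/2) * g 1"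
    unfolding sym_dirac_one_def by (simp add: nn_integral_mix nn_integral_return)
  also have "\<dots> = ennreal (1/2 + 1/2) * g 1"
    by (subst ennreal_plus) (simp_all add: distrib_right)
  finally show ?thesis by simp
qed

lemma nn_integral_lborel_even:
  fixes f :: "real \<Rightarrow> ennreal"
  assumes [measurable]: "f \<in> borel_measurable borel" and even: "\<And>x. f (- x) = f x"
  shows "(\<integral>\<^sup>+x. f x \<partial>lborel) = 2 * (\<integral>\<^sup>+x. f x * indicator {0<..} x \<partial>lborel)"
proof -
  have "(\<integral>\<^sup>+x. f x \<partial>lborel) =
      (\<integral>\<^sup>+x. f x * indicator {0<..} x + f x * indicator {..<0} x \<partial>lborel)"
    by (rule nn_integral_cong_AE, use AE_lborel_singleton[of "0::real"] in eventually_elim)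
      (auto simp: indicator_def)
  also have "\<dots> = (\<integral>\<^sup>+x. f x * indicator {0<..} x \<partial>lborel) + (\<integral>\<^sup>+x. f x * indicator {..<0} x \<partial>lborel)"
    by (rule nn_integral_add) simp_all
  also have "(\<integral>\<^sup>+x. f x * indicator {..<0} x \<partial>lborel) = (\<integral>\<^sup>+x. f x * indicator {0<..} x \<partial>lborel)"
    by (subst nn_integral_real_affine[where c = "-1" and t = 0])
      (auto simp: even indicator_def intro!: nn_integral_cong)
  finally show ?thesis by (simp add: mult_2)
qed

text \<open>An even function only sees the law of \<open>\<bar>\<theta>\<bar>\<close>, the one-sided Pareto distribution.  The
  half-open range is replaced by the closed one to match the fundamental theorem of calculus.\<close>

lemma nn_integral_sym_pareto_even:
  fixes g :: "real \<Rightarrow> ennreal"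
  assumes "0 < \<alpha>" and [measurable]: "g \<in> borel_measurable borel"
  shows "(\<integral>\<^sup>+x. g \<bar>x\<bar> \<partial>sym_pareto \<alpha>) =
    (\<integral>\<^sup>+x. ennreal (\<alpha> / x powr (\<alpha> + 1)) * g x * indicator {1..} x \<partial>lborel)"
proof -
  let ?d = "\<lambda>x. ennreal (\<alpha> / (2 * \<bar>x\<bar> powr (\<alpha> + 1)) * indicator {1<..} \<bar>x\<bar>)"
  have "(\<integral>\<^sup>+x. g \<bar>x\<bar> \<partial>sym_pareto \<alpha>) = (\<integral>\<^sup>+x. ?d x * g \<bar>x\<bar> \<partial>lborel)"
    unfolding sym_pareto_def by (rule nn_integral_density) simp_all
  also have "\<dots> = 2 * (\<integral>\<^sup>+x. ?d x * g \<bar>x\<bar> * indicator {0<..} x \<partial>lborel)"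
    by (rule nn_integral_lborel_even) simp_all
  also have "\<dots> = (\<integral>\<^sup>+x. 2 * (?d x * g \<bar>x\<bar> * indicator {0<..} x) \<partial>lborel)"
    by (rule nn_integral_cmult[symmetric]) simp
  also have "\<dots> = (\<integral>\<^sup>+x. ennreal (\<alpha> / x powr (\<alpha> + 1)) * g x * indicator {1..} x \<partial>lborel)"
  proof (rule nn_integral_cong_AE, use AE_lborel_singleton[of "1::real"] in eventually_elim)
    fix x :: real assume "x \<noteq> 1"
    have "2 * ennreal (\<alpha> / (2 * x powr (\<alpha> + 1))) = ennreal (\<alpha> / x powr (\<alpha> + 1))"
      using \<open>0 < \<alpha>\<close> ennreal_mult[of 2 "\<alpha> / (2 * x powr (\<alpha> + 1))"] by simp
    then show "2 * (?d x * g \<bar>x\<bar> * indicator {0<..} x)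
        = ennreal (\<alpha> / x powr (\<alpha> + 1)) * g x * indicator {1..} x"
      using \<open>x \<noteq> 1\<close> by (auto simp: indicator_def mult.assoc[symmetric])
  qed
  finally show ?thesis .
qed

lemma real_distribution_sym_pareto:
  assumes "0 < \<alpha>"
  shows "real_distribution (sym_pareto \<alpha>)"
proof -
  have "(\<integral>\<^sup>+x. 1 \<partial>sym_pareto \<alpha>) =
      (\<integral>\<^sup>+x. ennreal (\<alpha> / x powr (\<alpha> + 1)) * indicator {1..} x \<partial>lborel)"
    using nn_integral_sym_pareto_even[OF assms, of "\<lambda>_. 1"] by simp
  also have "\<dots> = ennreal (0 - - (1 powr - \<alpha>))"
  proof (rule nn_integral_FTC_atLeast)
    show "((\<lambda>x. - (x powr - \<alpha>)) \<longlongrightarrow> 0) at_top"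
      using tendsto_minus[OF tendsto_neg_powr[OF _ filterlim_ident, of "- \<alpha>"]] assms by simp
    show "DERIV (\<lambda>x. - (x powr - \<alpha>)) x :> \<alpha> / x powr (\<alpha> + 1)" if "1 \<le> x" for x
    proof -
      have "x powr (- \<alpha> - 1) = 1 / x powr (\<alpha> + 1)"
        using powr_minus_divide[of x "\<alpha> + 1"] by simp
      then show ?thesis
        using DERIV_minus[OF has_real_derivative_powr[of x "- \<alpha>"]] that by simp
    qed
  qed (use assms in auto)
  finally have "emeasure (sym_pareto \<alpha>) (space (sym_pareto \<alpha>)) = 1"
    by simp
  then show ?thesis
    by (auto simp: real_distribution_def real_distribution_axioms_def sym_pareto_def intro: prob_spaceI)
qed

section \<open>The power profile as a mixture of tents\<close>

text \<open>Carrying the weight \<open>1 - \<alpha>\<close> inside the integral makes the antiderivative free of the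
  denominator \<open>1 - \<alpha>\<close>, so that \<open>\<alpha> = 1\<close> is not exceptional.\<close>

lemma nn_integral_tent_pareto:
  fixes \<alpha> s :: real
  assumes \<alpha>: "0 < \<alpha>" "\<alpha> \<le> 1" and s: "0 < s" "s < 1"
  shows "ennreal (1 - \<alpha>) * (\<integral>\<^sup>+x. ennreal (max (1 - s * \<bar>x\<bar>) 0) \<partial>sym_pareto \<alpha>) =
    ennreal (1 - s powr \<alpha> - \<alpha> * (1 - s))"
proof -
  define F where "F x = - (1 - \<alpha>) * x powr (- \<alpha>) - s * \<alpha> * x powr (1 - \<alpha>)" for x
  let ?f = "\<lambda>x. (1 - \<alpha>) * (\<alpha> / x powr (\<alpha> + 1)) * (1 - s * x)"
  have "ennreal (1 - \<alpha>) * (\<integral>\<^sup>+x. ennreal (max (1 - s * \<bar>x\<bar>) 0) \<partial>sym_pareto \<alpha>) =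
      ennreal (1 - \<alpha>) * (\<integral>\<^sup>+x. ennreal (\<alpha> / x powr (\<alpha> + 1)) * ennreal (max (1 - s * x) 0)
        * indicator {1..} x \<partial>lborel)"
    by (subst nn_integral_sym_pareto_even[OF \<alpha>(1), of "\<lambda>x. ennreal (max (1 - s * x) 0)"]) simp_all
  also have "\<dots> = (\<integral>\<^sup>+x. ennreal (1 - \<alpha>) * (ennreal (\<alpha> / x powr (\<alpha> + 1))
        * ennreal (max (1 - s * x) 0) * indicator {1..} x) \<partial>lborel)"
    by (rule nn_integral_cmult[symmetric]) simp
  also have "\<dots> = (\<integral>\<^sup>+x. ennreal (?f x) * indicator {1..1 / s} x \<partial>lborel)"
  proof (rule nn_integral_cong)
    fix x :: real
    consider "x < 1" | "1 \<le> x" "x \<le> 1 / s" | "1 \<le> x" "1 / s < x" by linarith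
    then show "ennreal (1 - \<alpha>) * (ennreal (\<alpha> / x powr (\<alpha> + 1)) * ennreal (max (1 - s * x) 0)
        * indicator {1..} x) = ennreal (?f x) * indicator {1..1 / s} x"
    proof cases
      case 2
      then have "0 \<le> 1 - s * x" using s by (simp add: field_simps)
      then show ?thesis using 2 \<alpha> by (simp add: ennreal_mult'[symmetric] mult.assoc)
    next
      case 3
      then have "1 - s * x < 0" using s by (simp add: field_simps)
      then show ?thesis using 3 by simp
    qed simp
  qed
  also have "\<dots> = ennreal (F (1 / s) - F 1)"
  proof (rule nn_integral_FTC_Icc)
    fix x assume x: "x \<in> {1..1 / s}"
    then have "0 < x" by auto
    moreover have "x powr (1 - \<alpha> - 1) = x * x powr (- \<alpha> - 1)"
      using \<open>0 < x\<close> by (simp add: powr_mult_base)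
    moreover have "1 / x powr (\<alpha> + 1) = x powr (- \<alpha> - 1)"
      by (simp add: powr_minus_divide[symmetric])
    ultimately show "DERIV F x :> ?f x"
      unfolding F_def by (auto intro!: derivative_eq_intros simp: divide_inverse algebra_simps)
    have "0 \<le> 1 - s * x" using x s by (simp add: field_simps)
    then show "0 \<le> ?f x" using \<alpha> by (intro mult_nonneg_nonneg) auto
  qed (use s in auto)
  also have "F (1 / s) - F 1 = 1 - s powr \<alpha> - \<alpha> * (1 - s)"
  proof -
    have "(1 / s) powr (- \<alpha>) = s powr \<alpha>"
      using s by (simp add: powr_divide powr_minus_divide)
    moreover have "s * (1 / s) powr (1 - \<alpha>) = s powr \<alpha>"
      using s by (simp add: powr_divide powr_diff)
    ultimately have "F (1 / s) = - (1 - \<alpha>) * s powr \<alpha> - \<alpha> * s powr \<alpha>"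
      unfolding F_def by (metis mult.assoc mult.commute)
    then show ?thesis by (simp add: F_def algebra_simps)
  qed
  finally show ?thesis .
qed

text \<open>The unit-width tent contributed by the atoms accounts for the left slope \<open>-\<alpha>\<close> of
  \<open>(1 - s powr \<alpha>)\<^sub>+\<close> at the edge \<open>s = 1\<close> of its support.  Beyond the edge every tent vanishes,
  since the mixing measure lives on \<open>\<bar>\<theta>\<bar> \<ge> 1\<close>.\<close>

lemma nn_integral_tent_mix:
  fixes \<alpha> s :: real
  assumes \<alpha>: "0 < \<alpha>" "\<alpha> \<le> 1" and "0 < s"
  shows "(\<integral>\<^sup>+x. ennreal (max (1 - s * \<bar>x\<bar>) 0) \<partial>mix \<alpha> sym_dirac_one (1 - \<alpha>) (sym_pareto \<alpha>)) =
    ennreal (max (1 - s powr \<alpha>) 0)"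
proof -
  have "(\<integral>\<^sup>+x. ennreal (max (1 - s * \<bar>x\<bar>) 0) \<partial>mix \<alpha> sym_dirac_one (1 - \<alpha>) (sym_pareto \<alpha>)) =
      ennreal \<alpha> * (\<integral>\<^sup>+x. ennreal (max (1 - s * \<bar>x\<bar>) 0) \<partial>sym_dirac_one) +
      ennreal (1 - \<alpha>) * (\<integral>\<^sup>+x. ennreal (max (1 - s * \<bar>x\<bar>) 0) \<partial>sym_pareto \<alpha>)"
    by (rule nn_integral_mix) (simp_all add: sym_dirac_one_def sym_pareto_def)
  also have "(\<integral>\<^sup>+x. ennreal (max (1 - s * \<bar>x\<bar>) 0) \<partial>sym_dirac_one) = ennreal (max (1 - s) 0)"
    using nn_integral_sym_dirac_one_even[of "\<lambda>x. ennreal (max (1 - s * x) 0)"] by simp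
  also have "ennreal \<alpha> * ennreal (max (1 - s) 0) +
      ennreal (1 - \<alpha>) * (\<integral>\<^sup>+x. ennreal (max (1 - s * \<bar>x\<bar>) 0) \<partial>sym_pareto \<alpha>) =
      ennreal (max (1 - s powr \<alpha>) 0)"
  proof (cases "s < 1")
    case True
    \<comment> \<open>The Pareto part must be nonnegative as a real number, since \<open>ennreal\<close> truncates.  It is,
      because the graph of the concave function \<open>s powr \<alpha>\<close> lies below its tangent at \<open>1\<close>.\<close>
    have "\<alpha> * (1 - s) \<le> 1 - s powr \<alpha>"
      using Youngs_inequality_0[of \<alpha> "1 - \<alpha>" s 1] \<alpha> \<open>0 < s\<close> by (simp add: algebra_simps)
    moreover have "0 \<le> \<alpha> * (1 - s)" using \<alpha> True by simp
    ultimately have "ennreal (\<alpha> * (1 - s)) + ennreal (1 - s powr \<alpha> - \<alpha> * (1 - s)) =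
        ennreal (1 - s powr \<alpha>)"
      by (simp flip: ennreal_plus)
    then show ?thesis
      unfolding nn_integral_tent_pareto[OF \<alpha> \<open>0 < s\<close> True]
      using True \<alpha> by (simp flip: ennreal_mult')
  next
    case False
    have vanish: "ennreal (\<alpha> / x powr (\<alpha> + 1)) * ennreal (max (1 - s * x) 0)
        * indicator {1..} x = 0" for x
      using mult_mono[of 1 s 1 x] False by (auto simp: indicator_def max_def)
    have "(\<integral>\<^sup>+x. ennreal (max (1 - s * \<bar>x\<bar>) 0) \<partial>sym_pareto \<alpha>) =
        (\<integral>\<^sup>+x. ennreal (\<alpha> / x powr (\<alpha> + 1)) * ennreal (max (1 - s * x) 0)
          * indicator {1..} x \<partial>lborel)"
      by (rule nn_integral_sym_pareto_even[OF \<alpha>(1)]) simp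
    also have "\<dots> = 0"
      unfolding vanish by simp
    finally have "(\<integral>\<^sup>+x. ennreal (max (1 - s * \<bar>x\<bar>) 0) \<partial>sym_pareto \<alpha>) = 0" .
    moreover have "1 \<le> s powr \<alpha>" using False \<alpha> by (intro ge_one_powr_ge_zero) auto
    ultimately show ?thesis using False by (simp add: max_def)
  qed
  finally show ?thesis .
qed

theorem lemma3p12:
  fixes \<alpha> :: real and \<mu>\<^sub>1 \<mu>\<^sub>\<alpha> :: "real measure"
  assumes "0 < \<alpha>" and "\<alpha> \<le> 1"
    and "real_distribution \<mu>\<^sub>1"
    and "\<And>t. char \<mu>\<^sub>1 t = complex_of_real (max (1 - \<bar>t\<bar>) 0)"
    and "real_distribution \<mu>\<^sub>\<alpha>"
    and "\<And>t. char \<mu>\<^sub>\<alpha> t = complex_of_real (max (1 - \<bar>t\<bar> powr \<alpha>) 0)"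
  shows "\<mu>\<^sub>\<alpha> = \<mu>\<^sub>1 \<circ>\<^sub>m mix \<alpha> sym_dirac_one (1 - \<alpha>) (sym_pareto \<alpha>)"
proof -
  let ?N = "mix \<alpha> sym_dirac_one (1 - \<alpha>) (sym_pareto \<alpha>)"
  have N: "real_distribution ?N"
    using assms(1,2)
    by (intro real_distribution_mix real_distribution_sym_dirac_one real_distribution_sym_pareto)
      simp_all
  have P: "real_distribution (\<mu>\<^sub>1 \<circ>\<^sub>m ?N)"
    by (rule real_distribution_mult_conv[OF assms(3) N])
  have "char \<mu>\<^sub>\<alpha> t = char (\<mu>\<^sub>1 \<circ>\<^sub>m ?N) t" for t
  proof (cases "t = 0")
    case True
    then show ?thesis
      using real_distribution.char_zero[OF assms(5)] real_distribution.char_zero[OF P] by simp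
  next
    case False
    have "char (\<mu>\<^sub>1 \<circ>\<^sub>m ?N) t = complex_of_real (\<integral>x. max (1 - \<bar>t\<bar> * \<bar>x\<bar>) 0 \<partial>?N)"
      by (simp only: char_mult_conv[OF assms(3) N] assms(4) abs_mult integral_complex_of_real)
    also have "(\<integral>x. max (1 - \<bar>t\<bar> * \<bar>x\<bar>) 0 \<partial>?N) = max (1 - \<bar>t\<bar> powr \<alpha>) 0"
    proof (subst integral_eq_nn_integral)
      have "0 < \<bar>t\<bar>" using False by simp
      show "enn2real (\<integral>\<^sup>+x. ennreal (max (1 - \<bar>t\<bar> * \<bar>x\<bar>) 0) \<partial>?N) = max (1 - \<bar>t\<bar> powr \<alpha>) 0"
        unfolding nn_integral_tent_mix[OF assms(1,2) \<open>0 < \<bar>t\<bar>\<close>] by (rule enn2real_ennreal) simp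
    qed simp_all
    finally show ?thesis by (simp add: assms(6))
  qed
  then show ?thesis
    by (intro Levy_uniqueness assms(5) P ext)
qed

end
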